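(* Let $\alpha = n \in \mathbb{Z}$. Consider on $\mathbb{C}^4$ with coordinates $(q,p,z,F)$ and canonical symplectic structure $dp\wedge dq + dF\wedge dz$ the Hamiltonian $$\widehat{H}(q,p,z,F) = \tfrac12 p^2 + F - \left(q^2 + \tfrac12 z\right)p - \left(\alpha + \tfrac12\right) q$$ and the corresponding autonomous Hamiltonian system $$\frac{dq}{ds} = p - q^2 - \tfrac12 z, \qquad \frac{dz}{ds} = 1, \qquad \frac{dp}{ds} = 2qp + \alpha + \tfrac12, \qquad \frac{dF}{ds} = \tfrac12 p .$$ Then this system does not have a second rational first integral, that is, there is no rational function $\Phi \in \mathbb{C}(q,p,z,F)$ which is a first integral of the system and is functionally independent of $\widehat{H}$.
   Context: The second Painlevé equation $({\rm P}_{\rm II})$ is $\frac{d^2w}{dz^2} = 2w^3 + zw + \alpha$, where $\alpha$ is a complex parameter. It is equivalent to the non-autonomous Hamiltonian system $\frac{dq}{dz} = \frac{\partial H}{\partial p}$, $\frac{dp}{dz} = -\frac{\partial H}{\partial q}$ with $H = \frac12 p^2 - (q^2 + \frac12 z)p - (\alpha+\frac12)q$ (with $q = w$). The system in the claim is its autonomous extension to two degrees of freedom, in which $F$ is the variable conjugate to $z$: its equations are $\frac{dq}{ds} = \frac{\partial \widehat H}{\partial p}$, $\frac{dp}{ds} = -\frac{\partial \widehat H}{\partial q}$, $\frac{dz}{ds} = \frac{\partial \widehat H}{\partial F}$, $\frac{dF}{ds} = -\frac{\partial \widehat H}{\partial z}$. A rational function $\Phi(q,p,z,F)$ is a first integral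 if it is constant along solutions of the system (where defined), i.e. $$\left(p - q^2 - \tfrac12 z\right)\frac{\partial \Phi}{\partial q} + \left(2qp + \alpha + \tfrac12\right)\frac{\partial \Phi}{\partial p} + \frac{\partial \Phi}{\partial z} + \tfrac12 p\,\frac{\partial \Phi}{\partial F} = 0 .$$ $\widehat{H}$ itself is a first integral. $\Phi$ is functionally independent of $\widehat{H}$ if $d\Phi \wedge d\widehat{H}$ is not identically zero. *)

theory Defs
  imports Complex_Main "HOL-Computational_Algebra.Computational_Algebra"
begin

section \<open>Derivations on a field of fractions\<close>

definition derivation :: "('a::idom \<Rightarrow> 'a) \<Rightarrow> bool" where
  "derivation D \<longleftrightarrow> (\<forall>x y. D (x + y) = D x + D y) \<and> (\<forall>x y. D (x * y) = D x * y + x * D y)"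

text \<open>
  The quotient rule. The value is determined whenever \<open>D\<close> is a derivation, see
  \<open>fract_derivation_Fract\<close> below.
\<close>

definition fract_derivation :: "('a::idom \<Rightarrow> 'a) \<Rightarrow> 'a fract \<Rightarrow> 'a fract" where
  "fract_derivation D x =
     (THE y. \<exists>a b. b \<noteq> 0 \<and> x = Fract a b \<and> y = Fract (D a * b - a * D b) (b * b))"

lemma derivation_add: "derivation D \<Longrightarrow> D (x + y) = D x + D y"
  and derivation_mult: "derivation D \<Longrightarrow> D (x * y) = D x * y + x * D y"
  by (auto simp: derivation_def)

lemma derivation_0: "derivation D \<Longrightarrow> D 0 = 0"
  by (metis add.right_neutral add_left_cancel derivation_add)

lemma derivation_1: "derivation D \<Longrightarrow> D 1 = 0"
  by (metis add.right_neutral add_left_cancel derivation_mult mult_1_left mult_1_right)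

lemma derivation_pderiv: "derivation (pderiv :: 'a::idom poly \<Rightarrow> 'a poly)"
  by (auto simp: derivation_def pderiv_add pderiv_mult algebra_simps)

lemma derivation_map_poly:
  assumes "derivation D"
  shows "derivation (map_poly D)"
proof -
  have D0: "D 0 = 0" by (rule derivation_0[OF assms])
  have add: "map_poly D (p + q) = map_poly D p + map_poly D q" for p q
    by (rule poly_eqI) (simp add: coeff_map_poly D0 derivation_add[OF assms])
  have smult: "map_poly D (smult a q) = smult (D a) q + smult a (map_poly D q)" for a q
    by (rule poly_eqI) (simp add: coeff_map_poly D0 derivation_mult[OF assms])
  have pCons: "map_poly D (pCons a q) = pCons (D a) (map_poly D q)" for a q
    by (rule poly_eqI) (simp add: coeff_map_poly D0 coeff_pCons split: nat.splits)
  have mult: "map_poly D (p * q) = map_poly D p * q + p * map_poly D q" for p q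
    by (induction p) (simp_all add: add smult pCons D0 algebra_simps)
  show ?thesis
    using add mult by (simp add: derivation_def)
qed

lemma fract_derivation_Fract:
  assumes D: "derivation D" and b: "b \<noteq> 0"
  shows "fract_derivation D (Fract a b) = Fract (D a * b - a * D b) (b * b)"
  unfolding fract_derivation_def
proof (rule the_equality)
  show "\<exists>a' b'. b' \<noteq> 0 \<and> Fract a b = Fract a' b' \<and>
          Fract (D a * b - a * D b) (b * b) = Fract (D a' * b' - a' * D b') (b' * b')"
    using b by blast
next
  fix y
  assume "\<exists>a' b'. b' \<noteq> 0 \<and> Fract a b = Fract a' b' \<and>
            y = Fract (D a' * b' - a' * D b') (b' * b')"
  then obtain c d where d: "d \<noteq> 0" and eq: "Fract a b = Fract c d"
    and y: "y = Fract (D c * d - c * D d) (d * d)" by blast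
  have ad: "a * d = c * b" using eq b d by (simp add: eq_fract)
  have "D (a * d) = D (c * b)" by (simp only: ad)
  then have deriv: "D a * d + a * D d = D c * b + c * D b"
    by (simp add: derivation_mult[OF D])
  have "(D a * b - a * D b) * (d * d) = (D a * d + a * D d) * (b * d) - (a * d) * (D d * b + D b * d)"
    by (simp add: algebra_simps)
  also have "\<dots> = (D c * b + c * D b) * (b * d) - (c * b) * (D d * b + D b * d)"
    by (simp only: deriv ad)
  also have "\<dots> = (D c * d - c * D d) * (b * b)"
    by (simp add: algebra_simps)
  finally show "y = Fract (D a * b - a * D b) (b * b)"
    using b d by (simp add: y eq_fract)
qed

lemma derivation_fract_derivation:
  assumes D: "derivation D"
  shows "derivation (fract_derivation D)"
  unfolding derivation_def
proof (intro conjI allI)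
  fix x y :: "'a fract"
  obtain a b where x: "x = Fract a b" "b \<noteq> 0" by (cases x)
  obtain c d where y: "y = Fract c d" "d \<noteq> 0" by (cases y)
  show "fract_derivation D (x + y) = fract_derivation D x + fract_derivation D y"
    using x y by (simp add: fract_derivation_Fract[OF D] eq_fract
        derivation_add[OF D] derivation_mult[OF D]) (simp add: algebra_simps)
  show "fract_derivation D (x * y) = fract_derivation D x * y + x * fract_derivation D y"
    using x y by (simp add: fract_derivation_Fract[OF D] eq_fract
        derivation_add[OF D] derivation_mult[OF D]) (simp add: algebra_simps)
qed

lemma fract_derivation_to_fract:
  "derivation D \<Longrightarrow> fract_derivation D (to_fract a) = to_fract (D a)"
  by (simp add: to_fract_def fract_derivation_Fract derivation_1)


section \<open>Rational functions of \<open>q, p, z, F\<close>\<close>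

text \<open>
  \<open>\<complex>(q,p,z,F)\<close> is the field of fractions of \<open>\<complex>[F][z][p][q]\<close>: the outermost polynomial
  variable is \<open>q\<close>, the innermost one is \<open>F\<close>.
\<close>

type_synonym polyfun = "complex poly poly poly poly"
type_synonym ratfun = "polyfun fract"

datatype coord = Cq | Cp | Cz | CF

definition const :: "complex \<Rightarrow> ratfun" where
  "const c = to_fract [:[:[:[:c:]:]:]:]"

fun var :: "coord \<Rightarrow> ratfun" where
  "var Cq = to_fract [:0, 1:]"
| "var Cp = to_fract [:[:0, 1:]:]"
| "var Cz = to_fract [:[:[:0, 1:]:]:]"
| "var CF = to_fract [:[:[:[:0, 1:]:]:]:]"

fun partial_poly :: "coord \<Rightarrow> polyfun \<Rightarrow> polyfun" where
  "partial_poly Cq = pderiv"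
| "partial_poly Cp = map_poly pderiv"
| "partial_poly Cz = map_poly (map_poly pderiv)"
| "partial_poly CF = map_poly (map_poly (map_poly pderiv))"

definition partial :: "coord \<Rightarrow> ratfun \<Rightarrow> ratfun" where
  "partial i = fract_derivation (partial_poly i)"

lemma derivation_partial_poly: "derivation (partial_poly i)"
  by (cases i) (simp_all add: derivation_pderiv derivation_map_poly)

lemma derivation_partial: "derivation (partial i)"
  unfolding partial_def by (intro derivation_fract_derivation derivation_partial_poly)

lemma partial_Fract:
  "b \<noteq> 0 \<Longrightarrow>
     partial i (Fract a b) = Fract (partial_poly i a * b - a * partial_poly i b) (b * b)"
  unfolding partial_def by (rule fract_derivation_Fract[OF derivation_partial_poly])

lemma partial_add: "partial i (\<Phi> + \<Psi>) = partial i \<Phi> + partial i \<Psi>"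
  and partial_mult: "partial i (\<Phi> * \<Psi>) = partial i \<Phi> * \<Psi> + \<Phi> * partial i \<Psi>"
  by (rule derivation_add[OF derivation_partial] derivation_mult[OF derivation_partial])+

lemma partial_diff: "partial i (\<Phi> - \<Psi>) = partial i \<Phi> - partial i \<Psi>"
  using partial_add[of i "\<Phi> - \<Psi>" \<Psi>] by simp

lemma partial_const: "partial i (const c) = 0"
  unfolding partial_def const_def
  by (cases i)
     (simp_all add: fract_derivation_to_fract derivation_pderiv derivation_map_poly
        map_poly_pCons derivation_0)

lemma partial_var: "partial i (var j) = (if i = j then 1 else 0)"
  unfolding partial_def
  by (cases i; cases j)
     (simp_all add: fract_derivation_to_fract derivation_pderiv derivation_map_poly
        map_poly_pCons pderiv_pCons derivation_0 map_poly_1' derivation_1 flip: one_pCons)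

lemma const_add: "const (a + b) = const a + const b"
  and const_mult: "const (a * b) = const a * const b"
  and const_0: "const 0 = 0"
  and const_1: "const 1 = 1"
  by (simp_all add: const_def flip: to_fract_add to_fract_mult one_pCons)


section \<open>First integrals of Hamiltonian systems\<close>

text \<open>
  The Hamiltonian vector field of \<open>H\<close> for the symplectic form \<open>dp \<and> dq + dF \<and> dz\<close>, where
  \<open>p\<close> is conjugate to \<open>q\<close> and \<open>F\<close> is conjugate to \<open>z\<close>.
\<close>

fun hamiltonian_field :: "ratfun \<Rightarrow> coord \<Rightarrow> ratfun" where
  "hamiltonian_field H Cq = partial Cp H"
| "hamiltonian_field H Cp = - partial Cq H"
| "hamiltonian_field H Cz = partial CF H"
| "hamiltonian_field H CF = - partial Cz H"

definition first_integral :: "(coord \<Rightarrow> ratfun) \<Rightarrow> ratfun \<Rightarrow> bool" where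
  "first_integral V \<Phi> \<longleftrightarrow>
     V Cq * partial Cq \<Phi> + V Cp * partial Cp \<Phi> + V Cz * partial Cz \<Phi> + V CF * partial CF \<Phi> = 0"

text \<open>The coefficient of \<open>dx\<^sub>i \<and> dx\<^sub>j\<close> in \<open>d\<Phi> \<and> d\<Psi>\<close>.\<close>

definition wedge_differentials :: "ratfun \<Rightarrow> ratfun \<Rightarrow> coord \<Rightarrow> coord \<Rightarrow> ratfun" where
  "wedge_differentials \<Phi> \<Psi> i j = partial i \<Phi> * partial j \<Psi> - partial j \<Phi> * partial i \<Psi>"

definition functionally_independent :: "ratfun \<Rightarrow> ratfun \<Rightarrow> bool" where
  "functionally_independent \<Phi> \<Psi> \<longleftrightarrow> (\<exists>i j. wedge_differentials \<Phi> \<Psi> i j \<noteq> 0)"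


section \<open>The extended Hamiltonian of the second Painleve equation\<close>

definition PII_hamiltonian :: "complex \<Rightarrow> ratfun" where
  "PII_hamiltonian \<alpha> =
     const (1/2) * (var Cp)^2 + var CF - ((var Cq)^2 + const (1/2) * var Cz) * var Cp
       - const (\<alpha> + 1/2) * var Cq"

lemma const_half_double: "const (1/2) * x + const (1/2) * x = x"
proof -
  have "const (1/2) * x + const (1/2) * x = const (1/2 + 1/2) * x"
    by (simp only: const_add distrib_right)
  then show ?thesis by (simp add: const_1)
qed

lemma PII_hamiltonian_field:
  "hamiltonian_field (PII_hamiltonian \<alpha>) Cq = var Cp - (var Cq)^2 - const (1/2) * var Cz"
  "hamiltonian_field (PII_hamiltonian \<alpha>) Cp = 2 * var Cq * var Cp + const (\<alpha> + 1/2)"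
  "hamiltonian_field (PII_hamiltonian \<alpha>) Cz = 1"
  "hamiltonian_field (PII_hamiltonian \<alpha>) CF = const (1/2) * var Cp"
  using const_half_double[of "var Cp"]
  by (simp_all add: PII_hamiltonian_def partial_add partial_diff partial_mult partial_const
        partial_var power2_eq_square algebra_simps del: var.simps)

lemma first_integral_PII_iff:
  "first_integral (hamiltonian_field (PII_hamiltonian \<alpha>)) \<Phi> \<longleftrightarrow>
     (var Cp - (var Cq)^2 - const (1/2) * var Cz) * partial Cq \<Phi>
     + (2 * var Cq * var Cp + const (\<alpha> + 1/2)) * partial Cp \<Phi>
     + partial Cz \<Phi> + const (1/2) * var Cp * partial CF \<Phi> = 0"
  by (simp add: first_integral_def PII_hamiltonian_field del: var.simps hamiltonian_field.simps)

lemma first_integral_hamiltonian: "first_integral (hamiltonian_field H) H"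
  by (simp add: first_integral_def algebra_simps)

end

theory Submission
  imports Defs "HOL-Computational_Algebra.Field_as_Ring"
begin

text \<open>
  Write a rational first integral as \<open>\<Phi> = a / b\<close> in lowest terms. Its derivative along the
  vector field \<open>\<delta>\<close> vanishes iff \<open>b * \<delta> a = a * \<delta> b\<close>, and by coprimality this means
  \<open>\<delta> a = c * a\<close> and \<open>\<delta> b = c * b\<close> for one polynomial \<open>c\<close>: numerator and denominator are
  Darboux polynomials with the same cofactor. The theorem follows from the claim
  (\<open>darboux_proportional\<close>) that two such polynomials are proportional over \<open>\<complex>[H]\<close>, where \<open>H\<close> is the
  extended Hamiltonian. For then \<open>\<Phi>\<close> lies in \<open>\<complex>(H)\<close>, and its differential is a multiple of the
  differential of \<open>H\<close>.

  To prove the claim, use \<open>y = p - q\<^sup>2 - z/2\<close>, the derivative of \<open>q\<close>, instead of \<open>p\<close>, and the value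
  \<open>h\<close> of \<open>H\<close> instead of \<open>F\<close>. The coordinate change is polynomial with polynomial inverse, and
  \<open>\<delta>\<close> becomes \<open>\<partial>\<^sub>z + y \<partial>\<^sub>q + (2q\<^sup>3 + zq + \<alpha>) \<partial>\<^sub>y\<close>, with \<open>k = \<complex>[h]\<close> as constants. Give
  \<open>q, y, z\<close> the weights \<open>1, 2, 2\<close>. Then \<open>\<delta> = D\<^sub>1 + D\<^sub>2\<close>, where \<open>D\<^sub>1 = y \<partial>\<^sub>q + (2q\<^sup>3 + zq) \<partial>\<^sub>y\<close>
  raises the weight by one and \<open>D\<^sub>2 = \<partial>\<^sub>z + \<alpha> \<partial>\<^sub>y\<close> lowers it by two. The field \<open>D\<^sub>1\<close> is the elliptic
  motion on the curves \<open>y\<^sup>2 = q\<^sup>4 + zq\<^sup>2 - E\<close>; its polynomial constants are the polynomials in \<open>z\<close>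
  and in \<open>E = q\<^sup>4 + zq\<^sup>2 - y\<^sup>2\<close>.

  Now let \<open>A, B\<close> be the forms of highest weight of two nonzero Darboux polynomials with
  cofactor \<open>c\<close>. Comparing weights, \<open>c = c\<^sub>1 + c\<^sub>0\<close> has only components of weight 1 and 0, and \<open>D\<^sub>1 A = c\<^sub>1 A\<close>, \<open>D\<^sub>1 B = c\<^sub>1 B\<close>.
  The reflection \<open>y \<mapsto> -y\<close> reverses \<open>D\<^sub>1\<close> and fixes \<open>c\<^sub>1\<close>, so with \<open>B'\<close> the reflection of \<open>B\<close>
  both \<open>g = A B'\<close> and \<open>n = B B'\<close> are constants of \<open>D\<^sub>1\<close>. The equations one and three weights below
  the top can be solved only if \<open>c\<^sub>0 = 0\<close> and if \<open>n D\<^sub>2 g - g D\<^sub>2 n\<close> is a \<open>D\<^sub>1\<close>-derivative. Since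
  \<open>D\<^sub>2 z = 1\<close> and \<open>D\<^sub>2 E = q\<^sup>2 - 2\<alpha>y\<close>, and since the differentials \<open>dq/y\<close> and \<open>q\<^sup>2 dq/y\<close> are
  independent modulo exact ones on the elliptic curve (\<open>elliptic_exactness\<close>), the quotient \<open>g/n = A/B\<close>
  depends neither on \<open>z\<close> nor on \<open>E\<close> (\<open>leading_forms_proportional\<close>). Thus \<open>s A = r B\<close> with
  \<open>r, s \<in> k\<close>, and \<open>A\<close> and \<open>B\<close> have equal weight. The same combination of the two Darboux polynomials
  is again Darboux with cofactor \<open>c\<close> but has smaller weight, so it is zero.
\<close>


section \<open>Ring morphisms and derivations on nested polynomials\<close>

definition ring_morphism :: "('a::comm_ring_1 \<Rightarrow> 'b::comm_ring_1) \<Rightarrow> bool" where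
  "ring_morphism h \<longleftrightarrow>
     (\<forall>x y. h (x + y) = h x + h y) \<and> (\<forall>x y. h (x * y) = h x * h y) \<and> h 1 = 1"

text \<open>
  If \<open>h\<close> is a ring morphism and \<open>D\<close>, \<open>E\<close> are
  derivations of its source and target, then \<open>h \<circ> D\<close> and \<open>E
  \<circ> h\<close> are derivations along \<open>h\<close>. Identities such as \<open>h
  \<circ> D = E \<circ> h\<close> thus have to be checked on generators only; every change
  of coordinates below is justified in this way.
\<close>
definition derivation_along ::
    "('a::comm_ring_1 \<Rightarrow> 'b::comm_ring_1) \<Rightarrow> ('a \<Rightarrow> 'b) \<Rightarrow> bool" where
  "derivation_along h d \<longleftrightarrow>
     (\<forall>x y. d (x + y) = d x + d y) \<and> (\<forall>x y. d (x * y) = d x * h y + h x * d y)"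

definition eval_poly :: "('a::comm_ring_1 \<Rightarrow> 'b::comm_ring_1) \<Rightarrow> 'b \<Rightarrow> 'a poly \<Rightarrow> 'b" where
  "eval_poly h x p = poly (map_poly h p) x"

lemma morphism_add: "ring_morphism h \<Longrightarrow> h (x + y) = h x + h y"
  and morphism_mult: "ring_morphism h \<Longrightarrow> h (x * y) = h x * h y"
  and morphism_1: "ring_morphism h \<Longrightarrow> h 1 = 1"
  by (auto simp: ring_morphism_def)

text \<open>
  The common source of the rules for morphisms and for derivations.
\<close>
lemma additive_facts:
  fixes f :: "'a::comm_ring_1 \<Rightarrow> 'b::comm_ring_1"
  assumes add: "\<And>x y. f (x + y) = f x + f y"
  shows "f 0 = 0" "f (- x) = - f x" "f (x - y) = f x - f y"
proof -
  show zero: "f 0 = 0"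
    using add[of 0 0] by simp
  show minus: "f (- x) = - f x" for x
    using add[of x "- x"] zero by (simp add: eq_neg_iff_add_eq_0 add.commute)
  show "f (x - y) = f x - f y"
    using add[of x "- y"] minus by simp
qed

lemma morphism_0: "ring_morphism h \<Longrightarrow> h 0 = 0"
  and morphism_minus: "ring_morphism h \<Longrightarrow> h (- x) = - h x"
  and morphism_diff: "ring_morphism h \<Longrightarrow> h (x - y) = h x - h y"
  by (simp_all add: additive_facts[of h] morphism_add)

lemma morphism_power: "ring_morphism h \<Longrightarrow> h (x ^ n) = h x ^ n"
  by (induction n) (simp_all add: morphism_1 morphism_mult)

lemma morphism_numeral: "ring_morphism h \<Longrightarrow> h (numeral n) = numeral n"
  by (induction n) (simp_all only: numeral.simps morphism_1 morphism_add)

lemmas morphism_simps = morphism_0 morphism_1 morphism_add morphism_minus morphism_diff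
  morphism_mult morphism_power morphism_numeral

lemma eval_poly_pCons:
  assumes "ring_morphism h"
  shows "eval_poly h x (pCons a p) = h a + x * eval_poly h x p"
  using assms by (simp add: eval_poly_def map_poly_pCons morphism_0)

lemma eval_poly_0: "eval_poly h x 0 = 0"
  by (simp add: eval_poly_def)

lemma ring_morphism_eval_poly:
  assumes "ring_morphism h"
  shows "ring_morphism (eval_poly h x)"
proof -
  note [simp] = eval_poly_pCons[OF assms] eval_poly_0 morphism_simps[OF assms]
  have add: "eval_poly h x (p + q) = eval_poly h x p + eval_poly h x q" for p q
    by (induction p q rule: poly_induct2) (simp_all add: algebra_simps)
  have smult: "eval_poly h x (smult a q) = h a * eval_poly h x q" for a q
    by (induction q) (simp_all add: algebra_simps)
  have mult: "eval_poly h x (p * q) = eval_poly h x p * eval_poly h x q" for p q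
    by (induction p) (simp_all add: add smult algebra_simps)
  show ?thesis
    using add mult by (simp add: ring_morphism_def one_pCons)
qed

lemma eval_poly_const: "ring_morphism h \<Longrightarrow> eval_poly h x [:c:] = h c"
  and eval_poly_variable: "ring_morphism h \<Longrightarrow> eval_poly h x [:0, 1:] = x"
  by (simp_all add: eval_poly_pCons eval_poly_0 morphism_simps)

lemma ring_morphism_id: "ring_morphism (\<lambda>x. x)"
  by (simp add: ring_morphism_def)

lemma ring_morphism_comp:
  "ring_morphism g \<Longrightarrow> ring_morphism h \<Longrightarrow> ring_morphism (\<lambda>x. g (h x))"
  by (simp add: ring_morphism_def)

lemma ring_morphism_const_poly: "ring_morphism (\<lambda>c. [:c:])"
  by (simp add: ring_morphism_def one_pCons)

lemma derivation_along_add: "derivation_along h d \<Longrightarrow> d (x + y) = d x + d y"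
  and derivation_along_mult: "derivation_along h d \<Longrightarrow> d (x * y) = d x * h y + h x * d y"
  by (simp_all add: derivation_along_def)

lemma derivation_along_0: "derivation_along h d \<Longrightarrow> d 0 = 0"
  by (simp add: additive_facts[of d] derivation_along_add)

lemma derivation_along_const_poly:
  "derivation_along h d \<Longrightarrow> derivation_along (\<lambda>c. h [:c:]) (\<lambda>c. d [:c:])"
  using derivation_along_add[of h d "[:x:]" "[:y:]" for x y]
    derivation_along_mult[of h d "[:x:]" "[:y:]" for x y]
  by (simp add: derivation_along_def)

lemma derivation_along_eqI:
  assumes d: "derivation_along h d" and e: "derivation_along h e"
    and const: "\<And>c. d [:c:] = e [:c:]" and variable: "d [:0, 1:] = e [:0, 1:]"
  shows "d p = e p"
proof (induction p)
  case 0
  then show ?case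
    by (simp add: derivation_along_0[OF d] derivation_along_0[OF e])
next
  case (pCons a p)
  have split: "pCons a p = [:a:] + [:0, 1:] * p"
    by simp
  show ?case
    unfolding split derivation_along_add[OF d] derivation_along_add[OF e]
      derivation_along_mult[OF d] derivation_along_mult[OF e]
    using pCons const variable by simp
qed

lemma morphism_eqI:
  assumes g: "ring_morphism g" and h: "ring_morphism h"
    and const: "\<And>c. g [:c:] = h [:c:]" and variable: "g [:0, 1:] = h [:0, 1:]"
  shows "g p = h p"
proof (induction p)
  case 0
  then show ?case
    by (simp add: morphism_0[OF g] morphism_0[OF h])
next
  case (pCons a p)
  have split: "pCons a p = [:a:] + [:0, 1:] * p"
    by simp
  show ?case
    unfolding split morphism_add[OF g] morphism_add[OF h] morphism_mult[OF g] morphism_mult[OF h]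
    using pCons const variable by simp
qed

lemmas derivation_map_pderiv = derivation_map_poly[OF derivation_pderiv]

lemma derivation_along_combine:
  assumes "derivation_along h d" "derivation_along h e"
  shows "derivation_along h (\<lambda>x. a * d x + b * e x)"
  using assms by (simp add: derivation_along_def algebra_simps)

lemma derivation_combine:
  fixes d e :: "'a::idom \<Rightarrow> 'a"
  assumes "derivation d" "derivation e"
  shows "derivation (\<lambda>x. a * d x + b * e x)"
  using assms by (simp add: derivation_def algebra_simps)

lemma derivation_facts:
  assumes "derivation D"
  shows "D 0 = 0" "D (x + y) = D x + D y" "D (x - y) = D x - D y" "D (- x) = - D x"
    "D (x * y) = D x * y + x * D y"
  using assms additive_facts[of D]
  by (auto simp: derivation_def)

lemma derivation_along_comp:
  fixes h :: "'a::idom \<Rightarrow> 'b::idom"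
  assumes "ring_morphism h"
  shows "derivation D \<Longrightarrow> derivation_along h (\<lambda>x. h (D x))"
    "derivation E \<Longrightarrow> derivation_along h (\<lambda>x. E (h x))"
  using assms by (simp_all add: derivation_def derivation_along_def ring_morphism_def)

lemma ring_morphism_comp_const: "ring_morphism g \<Longrightarrow> ring_morphism (\<lambda>c. g [:c:])"
  by (rule ring_morphism_comp[OF _ ring_morphism_const_poly])

text \<open>
  The Painleve coordinates: \<open>y\<close> is the outermost polynomial variable, then
  \<open>q\<close>, then \<open>z\<close>. The constants \<open>'k\<close> will be the
  polynomials in the value of the Hamiltonian.
\<close>
abbreviation vz :: "'k::idom poly poly poly" where "vz \<equiv> [:[:[:0, 1:]:]:]"
abbreviation vq :: "'k::idom poly poly poly" where "vq \<equiv> [:[:0, 1:]:]"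
abbreviation vy :: "'k::idom poly poly poly" where "vy \<equiv> [:0, 1:]"
abbreviation scalar :: "'k::idom \<Rightarrow> 'k poly poly poly" where "scalar c \<equiv> [:[:[:c:]:]:]"

lemma derivation_along_eqI3:
  fixes d :: "'k::idom poly poly poly \<Rightarrow> 'b::comm_ring_1"
  assumes d: "derivation_along h d" and e: "derivation_along h e"
    and "\<And>c. d (scalar c) = e (scalar c)" "d vz = e vz" "d vq = e vq" "d vy = e vy"
  shows "d p = e p"
proof -
  note d1 = derivation_along_const_poly[OF d] note e1 = derivation_along_const_poly[OF e]
  note d2 = derivation_along_const_poly[OF d1] note e2 = derivation_along_const_poly[OF e1]
  have 1: "d [:[:c:]:] = e [:[:c:]:]" for c
    by (rule derivation_along_eqI[OF d2 e2]) (simp_all add: assms)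
  have 2: "d [:c:] = e [:c:]" for c
    by (rule derivation_along_eqI[OF d1 e1]) (simp_all add: assms 1)
  show ?thesis
    by (rule derivation_along_eqI[OF d e]) (simp_all add: assms 2)
qed

lemma morphism_eqI3:
  fixes g :: "'k::idom poly poly poly \<Rightarrow> 'b::comm_ring_1"
  assumes g: "ring_morphism g" and h: "ring_morphism h"
    and "\<And>c. g (scalar c) = h (scalar c)" "g vz = h vz" "g vq = h vq" "g vy = h vy"
  shows "g p = h p"
proof -
  note g1 = ring_morphism_comp_const[OF g] note h1 = ring_morphism_comp_const[OF h]
  note g2 = ring_morphism_comp_const[OF g1] note h2 = ring_morphism_comp_const[OF h1]
  have 1: "g [:[:c:]:] = h [:[:c:]:]" for c
    by (rule morphism_eqI[OF g2 h2]) (simp_all add: assms)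
  have 2: "g [:c:] = h [:c:]" for c
    by (rule morphism_eqI[OF g1 h1]) (simp_all add: assms 1)
  show ?thesis
    by (rule morphism_eqI[OF g h]) (simp_all add: assms 2)
qed


section \<open>The elliptic field and its exact polynomials\<close>

definition cubic :: "'k::idom poly poly" where "cubic = [:0, [:0, 1:], 0, 2:]"
definition quartic :: "'k::idom poly poly" where "quartic = [:0, 0, [:0, 1:], 0, 1:]"

text \<open>
  The two weighted homogeneous parts of the Painleve field, \<open>y \<partial>\<^sub>q +
  (2q\<^sup>3 + zq) \<partial>\<^sub>y\<close> and \<open>\<partial>\<^sub>z + \<alpha>
  \<partial>\<^sub>y\<close>.
\<close>
definition lead_field :: "'k::idom poly poly poly \<Rightarrow> 'k poly poly poly" where
  "lead_field f = vy * map_poly pderiv f + [:cubic:] * pderiv f"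

definition low_field :: "'k::idom \<Rightarrow> 'k poly poly poly \<Rightarrow> 'k poly poly poly" where
  "low_field \<alpha> f = map_poly (map_poly pderiv) f + scalar \<alpha> * pderiv f"

text \<open>
  Along \<open>lead_field\<close> both \<open>z\<close> and the energy are constant, so
  the orbits lie on the elliptic curves \<open>y\<^sup>2 = quartic - energy\<close>.
\<close>
definition energy :: "'k::idom poly poly poly" where "energy = [:quartic, 0, -1:]"

lemma derivation_lead_field: "derivation lead_field"
  unfolding lead_field_def[abs_def]
  by (intro derivation_combine derivation_map_pderiv derivation_pderiv)

lemma derivation_low_field: "derivation (low_field \<alpha>)"
  using derivation_combine[OF derivation_map_poly[OF derivation_map_pderiv] derivation_pderiv,
      of 1 "scalar \<alpha>"]
  by (simp add: low_field_def[abs_def])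

lemmas lead_field_simps = derivation_facts[OF derivation_lead_field]
lemmas low_field_simps = derivation_facts[OF derivation_low_field]

lemma lead_field_coordinates:
  "lead_field (scalar c) = 0" "lead_field vz = 0" "lead_field vq = vy"
  "lead_field vy = [:cubic:]"
  by (simp_all add: lead_field_def map_poly_pCons pderiv_pCons map_poly_1')

lemma low_field_coordinates:
  "low_field \<alpha> (scalar c) = 0" "low_field \<alpha> vz = 1" "low_field \<alpha> vq = 0"
  "low_field \<alpha> vy = scalar \<alpha>"
  by (simp_all add: low_field_def map_poly_pCons pderiv_pCons map_poly_1' one_pCons)

text \<open>
  The argument is a polynomial in an energy variable with coefficients in
  \<open>k[z][q]\<close>. The next lemmas show that \<open>k[z][q][y]\<close> is free over
  these polynomials with basis \<open>1, y\<close>.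
\<close>
definition in_energy :: "'k::idom poly poly poly \<Rightarrow> 'k poly poly poly" where
  "in_energy u = pcompose u energy"

lemma in_energy_simps:
  "in_energy 0 = 0" "in_energy (u + v) = in_energy u + in_energy v"
  "in_energy (u - v) = in_energy u - in_energy v"
  "in_energy (- v) = - in_energy v"
  "in_energy (u * v) = in_energy u * in_energy v" "in_energy [:c:] = [:c:]"
  by (simp_all add: in_energy_def pcompose_add pcompose_diff pcompose_mult pcompose_uminus)

lemma in_energy_pCons: "in_energy (pCons c u) = [:c:] + energy * in_energy u"
  by (simp add: in_energy_def pcompose_pCons)

lemma degree_energy: "degree (energy :: 'k::idom poly poly poly) = 2"
  by (simp add: energy_def)

lemma vy_square: "vy * vy * in_energy v = in_energy ([:quartic, -1:] * v)"
proof -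
  have "vy * vy = [:quartic:] - (energy :: 'a poly poly poly)"
    by (simp add: energy_def)
  moreover have "in_energy [:quartic, -1:] = [:quartic:] - (energy :: 'a poly poly poly)"
    using one_pCons[where 'a = "'a poly poly"] by (simp only: in_energy_pCons in_energy_simps) simp
  ultimately show ?thesis
    by (simp only: in_energy_simps)
qed

lemma energy_decomposition: "\<exists>u v. f = in_energy u + vy * in_energy v"
proof (induction f)
  case 0
  have "(0 :: 'a poly poly poly) = in_energy 0 + vy * in_energy 0"
    by (simp add: in_energy_simps)
  then show ?case by blast
next
  case (pCons c f)
  then obtain u v where f: "f = in_energy u + vy * in_energy v" by blast
  have "pCons c f = [:c:] + vy * f"
    by simp
  also have "\<dots> = [:c:] + (vy * vy * in_energy v) + vy * in_energy u"
    unfolding f by (simp only: algebra_simps)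
  also have "\<dots> = in_energy ([:c:] + [:quartic, -1:] * v) + vy * in_energy u"
    by (simp only: vy_square in_energy_simps)
  finally show ?case by blast
qed

text \<open>
  The energy has degree two in \<open>y\<close>, so the two summands have even and odd
  degree in \<open>y\<close> and cannot cancel.
\<close>
lemma energy_decomposition_unique:
  assumes eq: "in_energy u + vy * in_energy v = in_energy u' + vy * in_energy v'"
  shows "u = u'" "v = v'"
proof -
  define a b where "a = u - u'" and "b = v' - v"
  have ab: "in_energy a = vy * in_energy b"
    using eq by (simp only: a_def b_def in_energy_simps) (simp only: algebra_simps)
  have zero: "x = 0" if "in_energy x = 0" for x :: "'a poly poly poly"
    using that pcompose_eq_0[of x energy] by (auto simp: in_energy_def degree_energy)
  have "b = 0"
  proof (rule ccontr)
    assume b: "b \<noteq> 0"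
    then have "in_energy b \<noteq> 0" using zero by blast
    then have "degree (vy * in_energy b) = 1 + 2 * degree b"
      by (simp add: in_energy_def degree_pcompose degree_energy degree_pCons_eq)
    moreover have "degree (in_energy a) = 2 * degree a"
      by (simp add: in_energy_def degree_pcompose degree_energy)
    ultimately have "2 * degree a = 1 + 2 * degree b"
      using ab by metis
    then show False
      by presburger
  qed
  moreover have "a = 0"
    by (rule zero) (simp add: ab \<open>b = 0\<close> in_energy_simps)
  ultimately show "u = u'" "v = v'"
    by (simp_all add: a_def b_def)
qed

lemma energy_eq: "(energy :: 'a::idom poly poly poly) = vq * vq * vq * vq + vz * (vq * vq) - vy * vy"
  by (simp add: energy_def quartic_def one_pCons)

lemma lead_field_energy: "lead_field (energy :: 'a::idom poly poly poly) = 0"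
proof -
  have cubic: "[:cubic:] = 2 * (vq * vq * vq) + vz * (vq :: 'a poly poly poly)"
    by (simp add: cubic_def numeral_poly)
  show ?thesis
    unfolding energy_eq lead_field_simps lead_field_coordinates cubic by algebra
qed

lemma low_field_energy:
  fixes \<alpha> :: "'a::idom"
  shows "low_field \<alpha> energy = [:[:0, 0, 1:]:] - 2 * scalar \<alpha> * vy"
proof -
  have square: "[:[:0, 0, 1:]:] = vq * (vq :: 'a poly poly poly)"
    by simp
  show ?thesis
    unfolding energy_eq low_field_simps low_field_coordinates square by algebra
qed

lemma lead_field_in_energy: "lead_field (in_energy u) = vy * in_energy (map_poly pderiv u)"
proof (induction u)
  case 0
  then show ?case by (simp add: in_energy_simps lead_field_simps)
next
  case (pCons c u)
  have "lead_field [:c:] = vy * [:pderiv c:]"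
    by (simp add: lead_field_def map_poly_pCons)
  then show ?case
    unfolding in_energy_pCons lead_field_simps lead_field_energy map_poly_pCons[where f = pderiv, OF pderiv_0] pCons
    by algebra
qed

lemma low_field_in_energy:
  "low_field \<alpha> (in_energy u) =
     in_energy (map_poly (map_poly pderiv) u) + low_field \<alpha> energy * in_energy (pderiv u)"
proof (induction u)
  case 0
  then show ?case by (simp add: in_energy_simps low_field_simps)
next
  case (pCons c u)
  have const: "low_field \<alpha> [:c:] = [:map_poly pderiv c:]"
    by (simp add: low_field_def map_poly_pCons)
  show ?case
    unfolding in_energy_pCons low_field_simps pderiv_pCons in_energy_simps pCons const pCons_0_0
      map_poly_pCons[where f = "map_poly pderiv", OF map_poly_0]
    by algebra
qed

text \<open>
  With \<open>Q = quartic - E\<close> and \<open>v\<close> independent of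
  \<open>y\<close>, the derivative of \<open>y v\<close> along the elliptic field is
  \<open>Q' v / 2 + Q v'\<close>, which has leading coefficient \<open>deg v + 2\<close>
  times that of \<open>v\<close>. This is where characteristic zero makes low degrees
  non-exact.
\<close>
lemma cubic_quartic_degree:
  fixes v :: "'k::{idom,ring_char_0} poly poly"
  assumes v: "v \<noteq> 0"
  shows "degree (cubic * v + quartic * pderiv v) \<ge> 3"
proof -
  define m where "m = degree v"
  have top: "coeff v k = 0" if "m < k" for k
    using that by (simp add: m_def coeff_eq_0)
  have "coeff (cubic * v + quartic * pderiv v) (Suc (Suc (Suc m))) = of_nat (m + 2) * coeff v m"
    by (cases m) (simp_all add: cubic_def quartic_def top coeff_pderiv coeff_pCons algebra_simps)
  also have "\<dots> \<noteq> 0"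
    using v by (simp add: m_def del: of_nat_add of_nat_Suc)
  finally show ?thesis
    using le_degree[of "cubic * v + quartic * pderiv v" "Suc (Suc (Suc m))"] by simp
qed

text \<open>
  By \<open>cubic_quartic_degree\<close>, the derivative of \<open>y v\<close> has degree
  at least three in \<open>q\<close> unless \<open>v\<close> vanishes. On a curve of fixed
  \<open>z\<close> and energy, where \<open>lead_field\<close> is \<open>y d/dq\<close>,
  this means that no nonzero combination of \<open>dq/y\<close>, \<open>q dq/y\<close>,
  \<open>q\<^sup>2 dq/y\<close> with constant coefficients is the differential of a
  polynomial, even after adding a polynomial multiple of \<open>dq\<close>. The induction
  runs through the powers of the energy from below, because \<open>y\<^sup>2\<close>
  involves the energy and thus couples neighbouring coefficients.
\<close>
lemma elliptic_exactness:
  fixes x w w' :: "'k::{idom,ring_char_0} poly poly poly"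
  assumes eq: "lead_field x = in_energy w + vy * in_energy w'"
    and deg: "\<And>j. degree (coeff w j) \<le> 2"
  shows "w = 0" "\<exists>u. x = in_energy u \<and> map_poly pderiv u = w'"
proof -
  obtain u v where x: "x = in_energy u + vy * in_energy v"
    using energy_decomposition by blast
  have "lead_field x = [:cubic:] * in_energy v + vy * vy * in_energy (map_poly pderiv v)
      + vy * in_energy (map_poly pderiv u)"
    unfolding x lead_field_simps lead_field_in_energy lead_field_coordinates by algebra
  also have "[:cubic:] * in_energy v + vy * vy * in_energy (map_poly pderiv v)
      = in_energy ([:cubic:] * v + [:quartic, -1:] * map_poly pderiv v)"
    by (simp only: vy_square in_energy_simps)
  finally have "lead_field x
      = in_energy ([:cubic:] * v + [:quartic, -1:] * map_poly pderiv v)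
        + vy * in_energy (map_poly pderiv u)"
    .
  from energy_decomposition_unique[OF trans[OF eq[symmetric] this]]
  have w: "w = [:cubic:] * v + [:quartic, -1:] * map_poly pderiv v"
    and w': "map_poly pderiv u = w'"
    by simp_all
  have coeff_v: "coeff v j = 0" for j
  proof (induction j rule: less_induct)
    case (less j)
    have "coeff w j = cubic * coeff v j + quartic * pderiv (coeff v j)"
      using less by (cases j) (simp_all add: w coeff_map_poly)
    then have "\<not> degree (cubic * coeff v j + quartic * pderiv (coeff v j)) \<ge> 3"
      using deg[of j] by simp
    then show ?case
      using cubic_quartic_degree by blast
  qed
  then have v: "v = 0"
    by (simp add: poly_eq_iff)
  show "w = 0"
    by (simp add: w v)
  show "\<exists>u. x = in_energy u \<and> map_poly pderiv u = w'"
    using w' x v by (auto simp: in_energy_simps)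
qed


section \<open>Proportionality of leading forms\<close>

text \<open>
  Reflection in \<open>y\<close>, which reverses time in the elliptic field.
\<close>
definition flip :: "'k::idom poly poly poly \<Rightarrow> 'k poly poly poly" where
  "flip f = pcompose f [:0, -1:]"

lemma ring_morphism_flip: "ring_morphism flip"
  by (simp add: ring_morphism_def flip_def pcompose_add pcompose_mult pcompose_1)

lemmas flip_simps = morphism_simps[OF ring_morphism_flip]

lemma flip_const: "flip [:c:] = [:c:]"
  by (simp add: flip_def)

lemma flip_vy: "flip vy = - vy"
  by (simp add: flip_def pcompose_pCons)

lemma flip_eq_0_iff: "flip f = 0 \<longleftrightarrow> f = 0"
  using pcompose_eq_0[of f "[:0, -1:]"] by (auto simp: flip_def)

lemma lead_field_flip: "lead_field (flip f) = - flip (lead_field f)"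
proof -
  note lead = derivation_along_comp[OF ring_morphism_flip derivation_lead_field]
  have minus: "derivation_along flip (\<lambda>x :: 'a poly poly poly. - flip (lead_field x))"
    using derivation_along_combine[OF lead(1) lead(1), of "-1" 0] by simp
  show ?thesis
    by (rule derivation_along_eqI3[OF lead(2) minus])
      (simp_all only: flip_const flip_vy lead_field_simps lead_field_coordinates flip_simps minus_zero minus_minus)
qed

lemma lead_coeff_pderiv_eq:
  fixes p :: "'a::{idom,ring_char_0} poly"
  shows "lead_coeff (pderiv p) = of_nat (degree p) * lead_coeff p"
  by (cases "degree p")
    (simp_all add: degree_pderiv coeff_pderiv coeff_eq_0)

text \<open>
  Comparison of leading coefficients: they carry the two degrees as factors.
\<close>
lemma wronskian_degree:
  fixes p q :: "'a::{idom,ring_char_0} poly"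
  assumes "q * pderiv p = p * pderiv q" "p \<noteq> 0" "q \<noteq> 0"
  shows "degree p = degree q"
proof -
  have "lead_coeff q * (of_nat (degree p) * lead_coeff p)
      = lead_coeff p * (of_nat (degree q) * lead_coeff q)"
    using arg_cong[OF assms(1), of lead_coeff]
    by (simp only: lead_coeff_mult lead_coeff_pderiv_eq)
  then have "(of_nat (degree p) :: 'a) * (lead_coeff p * lead_coeff q)
      = of_nat (degree q) * (lead_coeff p * lead_coeff q)"
    by (simp only: ac_simps)
  with assms show ?thesis
    by simp
qed

text \<open>
  Cancelling the leading term of \<open>p\<close> by a multiple of \<open>q\<close> leaves
  a polynomial that has the same vanishing Wronskian with \<open>q\<close> but smaller
  degree, which \<open>wronskian_degree\<close> excludes unless it is zero.
\<close>
lemma wronskian_proportional: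
  fixes p q :: "'a::{idom,ring_char_0} poly"
  assumes wronskian: "q * pderiv p = p * pderiv q" and q: "q \<noteq> 0"
  shows "smult (lead_coeff q) p = smult (lead_coeff p) q"
proof (cases "p = 0")
  case False
  define x where "x = smult (lead_coeff q) p - smult (lead_coeff p) q"
  have "q * pderiv x = smult (lead_coeff q) (q * pderiv p) - smult (lead_coeff p) (q * pderiv q)"
    by (simp add: x_def pderiv_diff pderiv_smult algebra_simps)
  also have "\<dots> = x * pderiv q"
    unfolding wronskian by (simp add: x_def algebra_simps)
  finally have x: "q * pderiv x = x * pderiv q" .
  have "x = 0"
  proof (rule ccontr)
    assume "x \<noteq> 0"
    then have "degree x = degree q"
      using wronskian_degree[OF x] q by simp
    moreover have "coeff x (degree q) = 0"
      using wronskian_degree[OF wronskian False q] by (simp add: x_def)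
    ultimately show False
      using \<open>x \<noteq> 0\<close> by (metis leading_coeff_0_iff)
  qed
  then show ?thesis
    by (simp add: x_def)
qed simp

text \<open>
  The outer variable gives proportionality over polynomials in the inner one; the two
  factors, being leading coefficients, then have vanishing Wronskian themselves.
\<close>
lemma two_variable_wronskian_proportional:
  fixes p q :: "'a::{idom,ring_char_0} poly poly"
  assumes outer: "q * pderiv p = p * pderiv q"
    and inner: "q * map_poly pderiv p = p * map_poly pderiv q" and q: "q \<noteq> 0"
  shows "\<exists>r s. s \<noteq> 0 \<and> smult [:s:] p = smult [:r:] q"
proof -
  define lp lq where "lp = lead_coeff p" and "lq = lead_coeff q"
  have lq: "lq \<noteq> 0"
    using q by (simp add: lq_def)
  have ratio: "smult lq p = smult lp q"
    using wronskian_proportional[OF outer q] by (simp add: lp_def lq_def)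
  note D = derivation_facts[OF derivation_map_pderiv]
  have D_smult: "map_poly pderiv (smult c f) = smult (pderiv c) f + smult c (map_poly pderiv f)"
    for c :: "'a poly" and f
    using D(5)[of "[:c:]" f] by (simp add: map_poly_pCons)
  have "smult (pderiv lq) p + smult lq (map_poly pderiv p)
      = smult (pderiv lp) q + smult lp (map_poly pderiv q)"
    using arg_cong[OF ratio, of "map_poly pderiv"] by (simp only: D_smult)
  then have "q * (smult (pderiv lq) p + smult lq (map_poly pderiv p))
      = q * (smult (pderiv lp) q + smult lp (map_poly pderiv q))"
    by (simp only:)
  then have "q * smult (pderiv lq) p + smult lq (q * map_poly pderiv p)
      = q * smult (pderiv lp) q + smult lp q * map_poly pderiv q"
    by (simp add: algebra_simps)
  also have "smult lq (q * map_poly pderiv p) = smult lp q * map_poly pderiv q"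
    unfolding inner mult_smult_left[symmetric] ratio ..
  finally have "q * smult (pderiv lq) p = q * smult (pderiv lp) q"
    by (rule add_right_imp_eq)
  then have "smult (pderiv lq) p = smult (pderiv lp) q"
    using q mult_left_cancel by blast
  then have "smult (pderiv lq) (smult lq p) = smult lq (smult (pderiv lp) q)"
    by (metis mult.commute smult_smult)
  then have "smult (pderiv lq * lp - lq * pderiv lp) q = 0"
    unfolding ratio by (simp add: smult_diff_left)
  then have "lq * pderiv lp = lp * pderiv lq"
    using q by (simp add: mult.commute)
  from wronskian_proportional[OF this lq]
  have "smult (smult (lead_coeff lq) lp) q = smult (smult (lead_coeff lp) lq) q"
    by (simp only:)
  then have "smult lq (smult [:lead_coeff lq:] p) = smult lq (smult [:lead_coeff lp:] q)"
    using ratio by (metis (no_types, lifting) mult.commute mult_pCons_left pCons_0_0 add.right_neutral mult_zero_left smult_smult)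
  then have "smult [:lead_coeff lq:] p = smult [:lead_coeff lp:] q"
    using lq smult_cancel by blast
  with lq show ?thesis
    by (intro exI[of _ "lead_coeff lp"] exI[of _ "lead_coeff lq"]) simp
qed

text \<open>
  Polynomials in \<open>z\<close> and the energy, seen as polynomials in \<open>z\<close>,
  \<open>q\<close> and the energy that do not involve \<open>q\<close>.
\<close>
definition lift :: "'k::idom poly poly \<Rightarrow> 'k poly poly poly" where
  "lift = map_poly (\<lambda>c. [:c:])"

lemma coeff_lift: "coeff (lift g) j = [:coeff g j:]"
  by (simp add: lift_def coeff_map_poly)

lemma lift_simps:
  "lift (g + h) = lift g + lift h" "lift (g - h) = lift g - lift h"
  "pderiv (lift g) = lift (pderiv g)"
  "map_poly (map_poly pderiv) (lift g) = lift (map_poly pderiv g)"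
  by (rule poly_eqI, simp add: coeff_lift coeff_map_poly coeff_pderiv map_poly_pCons of_nat_poly
      del: of_nat_Suc)+

lemma lift_mult: "lift (g * h) = lift g * lift h"
proof (induction g)
  case 0
  then show ?case by (simp add: lift_def)
next
  case (pCons a g)
  have "lift (pCons a g) = pCons [:a:] (lift g)" "lift (smult a h) = smult [:a:] (lift h)"
    "lift (pCons 0 f) = pCons 0 (lift f)" for f :: "'a poly poly"
    by (rule poly_eqI, simp add: coeff_lift coeff_pCons mult.commute split: nat.splits)+
  with pCons show ?case
    by (simp add: lift_simps)
qed

lemma lead_field_kernel:
  fixes x :: "'k::{idom,ring_char_0} poly poly poly"
  assumes "lead_field x = 0"
  shows "\<exists>g. x = in_energy (lift g)"
proof -
  have "lead_field x = in_energy 0 + vy * in_energy 0"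
    by (simp add: assms in_energy_simps)
  from elliptic_exactness(2)[OF this] obtain u
    where x: "x = in_energy u" and u: "map_poly pderiv u = 0" by auto
  have "coeff u j = [:coeff (coeff u j) 0:]" for j
  proof -
    have "pderiv (coeff u j) = 0"
      using arg_cong[OF u, of "\<lambda>p. coeff p j"] by (simp add: coeff_map_poly)
    then show ?thesis
      by (auto simp: pderiv_eq_0_iff elim: degree_eq_zeroE)
  qed
  then have "u = lift (map_poly (\<lambda>c. coeff c 0) u)"
    by (simp add: poly_eq_iff[of u] coeff_lift coeff_map_poly)
  with x show ?thesis by metis
qed

text \<open>
  Here \<open>a\<close>, \<open>b\<close> are the forms of highest weight of two Darboux
  polynomials with common cofactor, of weight-one part \<open>c\<close> and weight-zero
  part \<open>\<kappa>\<close>; the other variables are components of lower weight,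
  numbered by their distance from the top. As \<open>c\<close> is free of
  \<open>y\<close>, multiplication by the reflection of \<open>b\<close> cancels it and
  turns each equation into an exactness statement for the elliptic field.
\<close>
lemma leading_forms_proportional:
  fixes a a2 a3 b b1 b2 b3 :: "'k::{idom,ring_char_0} poly poly poly"
  assumes b_nonzero: "b \<noteq> 0"
    and a: "lead_field a = [:c:] * a" and b: "lead_field b = [:c:] * b"
    and b1: "lead_field b1 = [:c:] * b1 + scalar \<kappa> * b"
    and a3: "lead_field a3 + low_field \<alpha> a = [:c:] * a3 + scalar \<kappa> * a2"
    and b3: "lead_field b3 + low_field \<alpha> b = [:c:] * b3 + scalar \<kappa> * b2"
  shows "\<exists>r s. s \<noteq> 0 \<and> scalar s * a = scalar r * b"
proof -
  define b' where "b' = flip b"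
  have b': "lead_field b' = - ([:c:] * b')"
    by (simp only: b'_def lead_field_flip b flip_simps flip_const)
  have b'_nonzero: "b' \<noteq> 0"
    using b_nonzero by (simp add: b'_def flip_eq_0_iff)
  have "lead_field (b * b') = 0" "lead_field (a * b') = 0"
    unfolding lead_field_simps a b b' by (simp_all only: algebra_simps) simp_all
  then obtain n g where n: "b * b' = in_energy (lift n)" and g: "a * b' = in_energy (lift g)"
    using lead_field_kernel by meson
  have n_nonzero: "n \<noteq> 0"
    using n b_nonzero b'_nonzero by (auto simp: lift_def in_energy_simps)
  have \<kappa>: "\<kappa> = 0"
  proof -
    have "lead_field (b1 * b') = scalar \<kappa> * (b * b')"
      unfolding lead_field_simps b1 b' by algebra
    also have "\<dots> = in_energy (scalar \<kappa> * lift n) + vy * in_energy 0"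
      unfolding n by (simp only: in_energy_simps mult_zero_right add_0_right)
    finally have "scalar \<kappa> * lift n = 0"
      by (rule elliptic_exactness(1)) (simp add: coeff_lift)
    moreover have "lift n \<noteq> 0"
      using n b_nonzero b'_nonzero by (auto simp: in_energy_simps)
    ultimately show ?thesis
      by simp
  qed
  have low: "low_field \<alpha> a = [:c:] * a3 - lead_field a3"
    "low_field \<alpha> b = [:c:] * b3 - lead_field b3"
    using a3 b3 \<kappa> by (simp_all add: algebra_simps)
  \<comment> \<open>Up to the factor \<open>b\<^sup>2 b'\<^sup>2\<close> this is the correction to the quotient \<open>a / b\<close> three weights
    below the top.\<close>
  define x where "x = (a3 * b - a * b3) * (b' * b')"
  have "lead_field x = (a * b') * low_field \<alpha> (b * b') - (b * b') * low_field \<alpha> (a * b')"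
    unfolding x_def lead_field_simps low_field_simps a b b' low by algebra
  also have "\<dots> = in_energy (lift (g * map_poly pderiv n - n * map_poly pderiv g)
        + [:[:0, 0, 1:]:] * lift (g * pderiv n - n * pderiv g))
      + vy * in_energy (- (2 * scalar \<alpha>) * lift (g * pderiv n - n * pderiv g))"
  proof -
    have "in_energy (- (2 * scalar \<alpha>)) = - (2 * scalar \<alpha>)"
      by (simp add: numeral_poly in_energy_simps)
    then show ?thesis
      unfolding n g low_field_in_energy low_field_energy lift_simps lift_mult in_energy_simps
      by algebra
  qed
  \<comment> \<open>The \<open>y\<close>-part is exact, being a derivative of a multiple of \<open>q\<close>. The rest has degree at most
    two in \<open>q\<close>, so both of its coefficients vanish.\<close>
  finally have "lift (g * map_poly pderiv n - n * map_poly pderiv g)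
        + [:[:0, 0, 1:]:] * lift (g * pderiv n - n * pderiv g) = 0" (is "lift ?u + _ * lift ?v = 0")
    by (rule elliptic_exactness(1)) (simp add: coeff_lift)
  then have "coeff (lift ?u + [:[:0, 0, 1:]:] * lift ?v) j = 0" for j
    by (simp only: coeff_0)
  then have uv: "coeff ?u j = 0" "coeff ?v j = 0" for j
    by (simp_all add: coeff_lift)
  have "?u = 0" "?v = 0"
    by (rule poly_eqI, simp only: uv coeff_0)+
  then obtain r s where s: "s \<noteq> 0" and ratio: "smult [:s:] g = smult [:r:] n"
    using two_variable_wronskian_proportional[of n g] n_nonzero by auto
  have "scalar s * lift g = scalar r * lift n"
    using arg_cong[OF ratio, of lift] by (simp add: poly_eq_iff coeff_lift)
  then have "in_energy (scalar s * lift g) = in_energy (scalar r * lift n)"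
    by (simp only:)
  then have "(scalar s * a) * b' = (scalar r * b) * b'"
    by (simp only: in_energy_simps mult.assoc n g)
  with s b'_nonzero show ?thesis
    by (metis mult_right_cancel)
qed


section \<open>The weight grading\<close>

definition PII_field :: "'k::idom \<Rightarrow> 'k poly poly poly \<Rightarrow> 'k poly poly poly" where
  "PII_field \<alpha> f = lead_field f + low_field \<alpha> f"

lemma derivation_PII_field: "derivation (PII_field \<alpha>)"
  using derivation_combine[OF derivation_lead_field derivation_low_field, of 1 1 \<alpha>]
  by (simp add: PII_field_def[abs_def])

lemmas PII_field_simps = derivation_facts[OF derivation_PII_field]

text \<open>
  The substitution \<open>q \<mapsto> tq\<close>, \<open>y \<mapsto> t\<^sup>2y\<close>,
  \<open>z \<mapsto> t\<^sup>2z\<close> with a new outermost variable \<open>t\<close>: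
  the coefficient of \<open>t\<^sup>k\<close> in \<open>rescale f\<close> is the component
  of \<open>f\<close> of weight \<open>k\<close>, and the degree is the weight of
  \<open>f\<close>. Weights are additive because polynomials over a domain have additive
  degrees.
\<close>
definition rescale :: "'k::idom poly poly poly \<Rightarrow> 'k poly poly poly poly" where
  "rescale = eval_poly (eval_poly (eval_poly (\<lambda>c. [:scalar c:]) (monom vz 2)) (monom vq 1)) (monom vy 2)"

lemma ring_morphism_scalar: "ring_morphism (\<lambda>c. [:scalar c:])"
  by (simp add: ring_morphism_def one_pCons)

lemma ring_morphism_rescale: "ring_morphism rescale"
  unfolding rescale_def by (intro ring_morphism_eval_poly ring_morphism_scalar)

lemmas rescale_simps = morphism_simps[OF ring_morphism_rescale]

lemma rescale_coordinates:
  "rescale (scalar c) = monom (scalar c) 0" "rescale vz = monom vz 2"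
  "rescale vq = monom vq 1" "rescale vy = monom vy 2"
  unfolding rescale_def
  by (simp_all only: eval_poly_const eval_poly_variable ring_morphism_eval_poly ring_morphism_scalar monom_0)

lemma rescale_at_1: "poly (rescale f) 1 = f"
proof (rule morphism_eqI3)
  show "ring_morphism (\<lambda>f. poly (rescale f) 1)"
    by (simp add: ring_morphism_def rescale_simps)
qed (simp_all only: ring_morphism_id rescale_coordinates poly_monom power_one mult_1_right)

lemma rescale_eq_0_iff: "rescale f = 0 \<longleftrightarrow> f = 0"
  using rescale_at_1[of f] by (auto simp: rescale_simps)

lemma map_poly_derivation_monom:
  fixes D :: "'a::idom \<Rightarrow> 'a"
  assumes "derivation D"
  shows "map_poly D (monom c n) = monom (D c) n"
    "map_poly D (monom 1 n * f) = monom 1 n * map_poly D f"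
proof -
  show monom: "map_poly D (monom c n) = monom (D c) n" for c
    by (simp add: map_poly_monom derivation_facts[OF assms])
  show "map_poly D (monom 1 n * f) = monom 1 n * map_poly D f"
    unfolding derivation_facts[OF derivation_map_poly[OF assms]]
    by (simp add: monom derivation_1[OF assms])
qed

text \<open>
  The elliptic part raises weights by one and the rest lowers them by two; multiplication
  by \<open>t\<^sup>2\<close> clears the negative power.
\<close>
lemma rescale_PII_field:
  "monom 1 2 * rescale (PII_field \<alpha> f) =
     monom 1 3 * map_poly lead_field (rescale f) + map_poly (low_field \<alpha>) (rescale f)"
proof -
  note morphism = ring_morphism_rescale
  note l = derivation_along_comp(1)[OF morphism derivation_PII_field]
  note r = derivation_along_comp(2)[OF morphism derivation_map_poly[OF derivation_lead_field]]
    derivation_along_comp(2)[OF morphism derivation_map_poly[OF derivation_low_field]]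
  note L = derivation_along_combine[OF l l, of "monom 1 2" \<alpha> 0 \<alpha>, unfolded mult_zero_left add_0_right]
  note R = derivation_along_combine[OF r, of "monom 1 3" 1 \<alpha>, unfolded mult_1_left]
  have cubic: "[:cubic:] = vq * vq * vq + vq * vq * vq + vz * (vq :: 'a poly poly poly)"
    by (simp add: cubic_def)
  note eval = PII_field_def lead_field_coordinates low_field_coordinates cubic rescale_simps
    rescale_coordinates map_poly_derivation_monom[OF derivation_lead_field]
    map_poly_derivation_monom[OF derivation_low_field] mult_monom add_monom
  show ?thesis
  proof (rule derivation_along_eqI3[OF L R])
    show "monom 1 2 * rescale (PII_field \<alpha> (scalar c)) =
        monom 1 3 * map_poly lead_field (rescale (scalar c))
        + map_poly (low_field \<alpha>) (rescale (scalar c))" for c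
      unfolding eval by simp
    show "monom 1 2 * rescale (PII_field \<alpha> vz) =
        monom 1 3 * map_poly lead_field (rescale vz) + map_poly (low_field \<alpha>) (rescale vz)"
      unfolding eval by simp
    show "monom 1 2 * rescale (PII_field \<alpha> vq) =
        monom 1 3 * map_poly lead_field (rescale vq) + map_poly (low_field \<alpha>) (rescale vq)"
      unfolding eval by (simp add: mult_monom)
    show "monom 1 2 * rescale (PII_field \<alpha> vy) =
        monom 1 3 * map_poly lead_field (rescale vy) + map_poly (low_field \<alpha>) (rescale vy)"
      unfolding eval distrib_left by (simp only: mult_monom mult_1_left) (simp add: add_monom)
  qed
qed

text \<open>
  The infinitesimal form of the rescaling. It recognises homogeneous polynomials as
  eigenvectors and so gives access to their coefficients.
\<close>
definition euler_field :: "'k::idom poly poly poly \<Rightarrow> 'k poly poly poly" where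
  "euler_field f = (vy * pderiv f + vy * pderiv f) + vq * map_poly pderiv f
     + (vz * map_poly (map_poly pderiv) f + vz * map_poly (map_poly pderiv) f)"

lemma derivation_euler_field: "derivation euler_field"
  by (simp add: derivation_def euler_field_def derivation_facts[OF derivation_pderiv]
      derivation_facts[OF derivation_map_pderiv]
      derivation_facts[OF derivation_map_poly[OF derivation_map_pderiv]]
      algebra_simps del: mult_pCons_left mult_pCons_right)

lemma euler_coordinates:
  "euler_field (scalar c) = 0" "euler_field vz = vz + vz" "euler_field vq = vq" "euler_field vy = vy + vy"
  by (simp_all add: euler_field_def map_poly_pCons pderiv_pCons
      derivation_1[OF derivation_map_pderiv]
      derivation_1[OF derivation_map_poly[OF derivation_map_pderiv]]
      flip: one_pCons)

lemma coeff_of_nat_mult: "coeff (of_nat n * p) k = of_nat n * coeff p k"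
  by (simp add: of_nat_poly)

lemma coeff_numeral_mult:
  "coeff (numeral m * p) k = numeral m * coeff p k" "coeff (p * numeral m) k = coeff p k * numeral m"
  by (simp_all add: numeral_poly mult.commute)

lemma coeff_euler:
  "coeff (coeff (coeff (euler_field f) i) j) l = of_nat (2 * i + j + 2 * l) * coeff (coeff (coeff f i) j) l"
  by (cases i; cases j; cases l)
    (simp_all add: euler_field_def coeff_map_poly coeff_pderiv coeff_of_nat_mult coeff_numeral_mult algebra_simps)

lemma euler_rescale: "map_poly euler_field (rescale f) = monom 1 1 * pderiv (rescale f)"
proof -
  note l = derivation_along_comp(2)[OF ring_morphism_rescale derivation_map_poly[OF derivation_euler_field]]
  note r = derivation_along_comp(2)[OF ring_morphism_rescale derivation_pderiv]
  note R = derivation_along_combine[OF r r, of "monom 1 1" 0, unfolded mult_zero_left add_0_right]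
  note eval = rescale_coordinates map_poly_derivation_monom[OF derivation_euler_field] euler_coordinates
    pderiv_monom mult_monom
  show ?thesis
    by (rule derivation_along_eqI3[OF l R], unfold eval)
      (simp_all add: numeral_poly eval_nat_numeral)
qed

lemma euler_coeff_rescale: "euler_field (coeff (rescale f) k) = of_nat k * coeff (rescale f) k"
proof -
  have "euler_field (coeff (rescale f) k) = coeff (map_poly euler_field (rescale f)) k"
    by (simp add: coeff_map_poly derivation_facts[OF derivation_euler_field])
  also have "\<dots> = of_nat k * coeff (rescale f) k"
    unfolding euler_rescale by (cases k) (simp_all add: coeff_monom_mult coeff_pderiv)
  finally show ?thesis .
qed

text \<open>
  The shift by \<open>t\<^sup>3\<close> makes the coefficients three steps below the top
  available even if the weight of \<open>f\<close> is smaller than three; they are then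
  zero.
\<close>
lemma darboux_graded:
  fixes c f :: "'k::{idom,ring_char_0} poly poly poly"
  assumes darboux: "PII_field \<alpha> f = c * f" and f: "f \<noteq> 0"
  defines "u \<equiv> monom 1 3 * rescale f" and "\<gamma> \<equiv> rescale c"
  shows "degree \<gamma> \<le> 1"
    "lead_field (coeff u k) + low_field \<alpha> (coeff u (k + 3))
       = coeff \<gamma> 1 * coeff u k + coeff \<gamma> 0 * coeff u (k + 1)"
proof -
  have u: "monom 1 2 * (\<gamma> * u) = monom 1 3 * map_poly lead_field u + map_poly (low_field \<alpha>) u"
  proof -
    have "monom 1 2 * (\<gamma> * u) = monom 1 3 * (monom 1 2 * rescale (PII_field \<alpha> f))"
      unfolding darboux rescale_simps u_def \<gamma>_def by algebra
    also have "\<dots> = monom 1 3 * map_poly lead_field u + map_poly (low_field \<alpha>) u"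
      unfolding rescale_PII_field u_def map_poly_derivation_monom[OF derivation_lead_field]
        map_poly_derivation_monom[OF derivation_low_field]
      by (simp only: distrib_left)
    finally show ?thesis .
  qed
  have "u \<noteq> 0"
    using f by (simp add: u_def rescale_eq_0_iff)
  show deg: "degree \<gamma> \<le> 1"
  proof (cases "\<gamma> = 0")
    case False
    have "degree (monom 1 2 * (\<gamma> * u)) = 2 + degree \<gamma> + degree u"
      using False \<open>u \<noteq> 0\<close> by (simp add: degree_mult_eq degree_monom_eq)
    moreover have "degree (monom 1 3 * map_poly lead_field u + map_poly (low_field \<alpha>) u) \<le> 3 + degree u"
    proof (rule degree_add_le)
      show "degree (monom 1 3 * map_poly lead_field u) \<le> 3 + degree u"
        by (rule order_trans[OF degree_mult_le])
          (simp add: degree_monom_eq map_poly_degree_leq)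
      show "degree (map_poly (low_field \<alpha>) u) \<le> 3 + degree u"
        using map_poly_degree_leq[of "low_field \<alpha>" u] by simp
    qed
    ultimately show ?thesis
      unfolding u by simp
  qed simp
  have "\<gamma> = monom (coeff \<gamma> 0) 0 + monom (coeff \<gamma> 1) 1"
  proof (rule poly_eqI)
    show "coeff \<gamma> n = coeff (monom (coeff \<gamma> 0) 0 + monom (coeff \<gamma> 1) 1) n" for n
      using deg by (cases "n \<le> 1") (auto simp: coeff_eq_0 le_Suc_eq)
  qed
  then have "monom 1 2 * (\<gamma> * u) = monom 1 2 * ((monom (coeff \<gamma> 0) 0 + monom (coeff \<gamma> 1) 1) * u)"
    by (simp only:)
  also have "\<dots> = monom (coeff \<gamma> 0) 2 * u + monom (coeff \<gamma> 1) 3 * u"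
    by (simp add: algebra_simps mult_monom eval_nat_numeral flip: mult.assoc)
  finally have "coeff (monom (coeff \<gamma> 0) 2 * u + monom (coeff \<gamma> 1) 3 * u) (k + 3)
      = coeff (monom 1 3 * map_poly lead_field u + map_poly (low_field \<alpha>) u) (k + 3)"
    using u by (simp only:)
  moreover have "k + 3 - 2 = k + 1"
    by simp
  ultimately show "lead_field (coeff u k) + low_field \<alpha> (coeff u (k + 3))
       = coeff \<gamma> 1 * coeff u k + coeff \<gamma> 0 * coeff u (k + 1)"
    by (simp add: coeff_monom_mult coeff_map_poly lead_field_simps low_field_simps add.commute)
qed

lemma euler_weight_0:
  fixes f :: "'k::{idom,ring_char_0} poly poly poly"
  assumes "euler_field f = 0"
  shows "\<exists>c. f = scalar c"
proof -
  have coeff: "coeff (coeff (coeff f i) j) l = 0" if "i \<noteq> 0 \<or> j \<noteq> 0 \<or> l \<noteq> 0" for i j l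
    using coeff_euler[of f i j l] that assms by (auto simp del: of_nat_add of_nat_mult)
  have "f = scalar (coeff (coeff (coeff f 0) 0) 0)"
    by (simp add: poly_eq_iff coeff_pCons coeff split: nat.splits)
  then show ?thesis by blast
qed

text \<open>
  A monomial of weight one cannot contain \<open>y\<close>, whose weight is two.
\<close>
lemma euler_weight_1:
  fixes f :: "'k::{idom,ring_char_0} poly poly poly"
  assumes "euler_field f = f"
  shows "\<exists>c. f = [:c:]"
proof -
  have "coeff (coeff (coeff f i) j) l = 0" if "i \<noteq> 0" for i j l
  proof -
    have "(of_nat (2 * i + j + 2 * l) - 1) * coeff (coeff (coeff f i) j) l = 0"
      using coeff_euler[of f i j l] assms by (simp add: left_diff_distrib del: of_nat_add of_nat_mult)
    moreover have "(of_nat (2 * i + j + 2 * l) :: 'k) \<noteq> of_nat 1"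
      using that by (simp only: of_nat_eq_iff)
    ultimately show ?thesis
      by simp
  qed
  then have "f = [:coeff f 0:]"
    by (simp add: poly_eq_iff coeff_pCons split: nat.splits)
  then show ?thesis by blast
qed

text \<open>
  The equations of \<open>darboux_graded\<close> at the top and one and three steps below
  it are those required for \<open>leading_forms_proportional\<close>. The Euler field
  then sees the same weight on both sides of the resulting proportionality.
\<close>
lemma darboux_same_weight:
  fixes c f g :: "'k::{idom,ring_char_0} poly poly poly"
  assumes f: "PII_field \<alpha> f = c * f" "f \<noteq> 0" and g: "PII_field \<alpha> g = c * g" "g \<noteq> 0"
  shows "degree (rescale f) = degree (rescale g)"
    "\<exists>r s. s \<noteq> 0 \<and> scalar s * lead_coeff (rescale f) = scalar r * lead_coeff (rescale g)"
proof -
  have "euler_field (coeff (rescale c) 0) = 0" "euler_field (coeff (rescale c) 1) = coeff (rescale c) 1"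
    using euler_coeff_rescale[of c 0] euler_coeff_rescale[of c 1] by simp_all
  then obtain c1 \<kappa> where c1: "coeff (rescale c) 1 = [:c1:]" and \<kappa>: "coeff (rescale c) 0 = scalar \<kappa>"
    using euler_weight_0 euler_weight_1 by meson
  define lf lg where "lf = lead_coeff (rescale f)" and "lg = lead_coeff (rescale g)"
  define u v where "u = monom 1 3 * rescale f" and "v = monom 1 3 * rescale g"
  define m n where "m = degree (rescale f)" and "n = degree (rescale g)"
  have top: "coeff u (m + 3) = lf" "coeff v (n + 3) = lg"
    by (simp_all add: u_def v_def m_def n_def lf_def lg_def coeff_monom_mult)
  have above: "coeff u k = 0" if "m + 3 < k" for k
    using that by (simp add: u_def m_def coeff_monom_mult coeff_eq_0)
  have above': "coeff v k = 0" if "n + 3 < k" for k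
    using that by (simp add: v_def n_def coeff_monom_mult coeff_eq_0)
  note F = darboux_graded(2)[OF f, folded u_def, unfolded c1 \<kappa>]
  note G = darboux_graded(2)[OF g, folded v_def, unfolded c1 \<kappa>]
  have lg: "lg \<noteq> 0" and lf: "lf \<noteq> 0"
    using f g by (simp_all add: lf_def lg_def rescale_eq_0_iff)
  have "\<exists>r s. s \<noteq> 0 \<and> scalar s * lf = scalar r * lg"
  proof (rule leading_forms_proportional[OF lg])
    show "lead_field lf = [:c1:] * lf"
      using F[of "m + 3"] by (simp add: top above low_field_simps)
    show "lead_field lg = [:c1:] * lg"
      using G[of "n + 3"] by (simp add: top above' low_field_simps)
    show "lead_field (coeff v (n + 2)) = [:c1:] * coeff v (n + 2) + scalar \<kappa> * lg"
      using G[of "n + 2"] top(2) by (simp add: above' low_field_simps numeral_3_eq_3)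
    show "lead_field (coeff u m) + low_field \<alpha> lf = [:c1:] * coeff u m + scalar \<kappa> * coeff u (m + 1)"
      using F[of m] by (simp only: top)
    show "lead_field (coeff v n) + low_field \<alpha> lg = [:c1:] * coeff v n + scalar \<kappa> * coeff v (n + 1)"
      using G[of n] by (simp only: top)
  qed
  then show ratio: "\<exists>r s. s \<noteq> 0 \<and> scalar s * lead_coeff (rescale f) = scalar r * lead_coeff (rescale g)"
    by (simp only: lf_def lg_def)
  from ratio obtain r s where s: "s \<noteq> 0" and eq: "scalar s * lf = scalar r * lg"
    unfolding lf_def lg_def by blast
  have scalar: "euler_field (scalar t * x) = scalar t * euler_field x" for t :: 'k and x
    unfolding derivation_facts[OF derivation_euler_field] euler_coordinates by simp
  have "of_nat m * (scalar s * lf) = scalar s * (of_nat m * lf)"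
    by (simp only: ac_simps)
  also have "of_nat m * lf = euler_field lf"
    by (simp only: lf_def m_def euler_coeff_rescale)
  also have "scalar s * euler_field lf = scalar r * euler_field lg"
    by (simp only: eq flip: scalar)
  also have "euler_field lg = of_nat n * lg"
    by (simp only: lg_def n_def euler_coeff_rescale)
  also have "scalar r * (of_nat n * lg) = of_nat n * (scalar s * lf)"
    unfolding eq by (simp only: ac_simps)
  finally have "m = n"
    using s lf by (simp only: mult_cancel_right) simp
  then show "degree (rescale f) = degree (rescale g)"
    by (simp add: m_def n_def)
qed

text \<open>
  The combination that cancels the leading forms is a Darboux polynomial with the same
  cofactor and of smaller weight. By \<open>darboux_same_weight\<close> it can only be
  zero.
\<close>
lemma darboux_proportional:
  fixes c f g :: "'k::{idom,ring_char_0} poly poly poly"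
  assumes f: "PII_field \<alpha> f = c * f" and g: "PII_field \<alpha> g = c * g" and nonzero: "g \<noteq> 0"
  shows "\<exists>r s. s \<noteq> 0 \<and> scalar s * f = scalar r * g"
proof (cases "f = 0")
  case True
  then show ?thesis
    by (intro exI[of _ 0] exI[of _ 1]) simp
next
  case False
  obtain r s where s: "s \<noteq> 0"
    and eq: "scalar s * lead_coeff (rescale f) = scalar r * lead_coeff (rescale g)"
    using darboux_same_weight(2)[OF f False g nonzero] by blast
  define h where "h = scalar s * f - scalar r * g"
  have scalar: "PII_field \<alpha> (scalar t) = 0" for t
    by (simp only: PII_field_def lead_field_coordinates low_field_coordinates add_0_right)
  have h: "PII_field \<alpha> h = c * h"
    unfolding h_def PII_field_simps f g scalar by algebra
  have "h = 0"
  proof (rule ccontr)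
    assume "h \<noteq> 0"
    then have deg: "degree (rescale h) = degree (rescale g)" "degree (rescale f) = degree (rescale g)"
      using darboux_same_weight(1)[OF _ _ g nonzero] h f False by blast+
    have "lead_coeff (rescale h) = scalar s * coeff (rescale f) (degree (rescale h))
        - scalar r * coeff (rescale g) (degree (rescale h))"
      unfolding h_def rescale_simps rescale_coordinates by (simp add: coeff_monom_mult)
    also have "\<dots> = 0"
      using eq by (simp only: deg) simp
    finally show False
      using \<open>h \<noteq> 0\<close> by (simp add: rescale_eq_0_iff)
  qed
  with s show ?thesis
    by (auto simp: h_def simp del: mult_pCons_left)
qed


section \<open>From the Hamiltonian system to the Painleve field\<close>

lemma polyfun_derivation_eqI:
  fixes d :: "polyfun \<Rightarrow> 'b::comm_ring_1"
  assumes d: "derivation_along h d" and e: "derivation_along h e"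
    and "\<And>c. d (scalar [:c:]) = e (scalar [:c:])" "d (scalar [:0, 1:]) = e (scalar [:0, 1:])"
    "d vz = e vz" "d vq = e vq" "d vy = e vy"
  shows "d p = e p"
proof (rule derivation_along_eqI3[OF d e])
  note const = derivation_along_const_poly
  show "d (scalar c) = e (scalar c)" for c
    by (rule derivation_along_eqI[OF const[OF const[OF const[OF d]]] const[OF const[OF const[OF e]]]])
      (simp_all only: assms)
qed (simp_all only: assms)

lemma polyfun_morphism_eqI:
  fixes g :: "polyfun \<Rightarrow> 'b::comm_ring_1"
  assumes g: "ring_morphism g" and h: "ring_morphism h"
    and "\<And>c. g (scalar [:c:]) = h (scalar [:c:])" "g (scalar [:0, 1:]) = h (scalar [:0, 1:])"
    "g vz = h vz" "g vq = h vq" "g vy = h vy"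
  shows "g p = h p"
proof (rule morphism_eqI3[OF g h])
  note const = ring_morphism_comp_const
  show "g (scalar c) = h (scalar c)" for c
    by (rule morphism_eqI[OF const[OF const[OF const[OF g]]] const[OF const[OF const[OF h]]]])
      (simp_all only: assms)
qed (simp_all only: assms)

abbreviation number :: "complex \<Rightarrow> polyfun" where "number c \<equiv> scalar [:c:]"

text \<open>
  The Hamiltonian coordinates, nested in the order of \<^typ>\<open>polyfun\<close>. As
  terms, \<open>coord_q\<close> and \<open>coord_p\<close> coincide with \<open>vy\<close>
  and \<open>vq\<close>; the names tell in which of the two coordinate systems a
  polynomial is read.
\<close>
abbreviation coord_q :: polyfun where "coord_q \<equiv> [:0, 1:]"
abbreviation coord_p :: polyfun where "coord_p \<equiv> [:[:0, 1:]:]"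
abbreviation coord_z :: polyfun where "coord_z \<equiv> [:[:[:0, 1:]:]:]"
abbreviation coord_F :: polyfun where "coord_F \<equiv> [:[:[:[:0, 1:]:]:]:]"

lemma number_simps:
  "number (a + b) = number a + number b" "number (a * b) = number a * number b"
  "number 1 = 1" "number 0 = 0"
  by (simp_all add: one_pCons)

definition hamiltonian_poly :: "complex \<Rightarrow> polyfun" where
  "hamiltonian_poly \<alpha> = number (1/2) * coord_p^2 + coord_F
     - (coord_q^2 + number (1/2) * coord_z) * coord_p - number (\<alpha> + 1/2) * coord_q"

definition hamiltonian_field_poly :: "complex \<Rightarrow> polyfun \<Rightarrow> polyfun" where
  "hamiltonian_field_poly \<alpha> f =
     (coord_p - coord_q^2 - number (1/2) * coord_z) * partial_poly Cq f
     + (2 * coord_q * coord_p + number (\<alpha> + 1/2)) * partial_poly Cp f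
     + partial_poly Cz f + number (1/2) * coord_p * partial_poly CF f"

text \<open>
  The substitution \<open>p = y + q\<^sup>2 + z/2\<close>, with \<open>F\<close> found by
  solving \<open>H = h\<close>. The innermost variable \<open>F\<close> makes room for
  \<open>h\<close>.
\<close>
definition to_PII :: "complex \<Rightarrow> polyfun \<Rightarrow> polyfun" where
  "to_PII \<alpha> = eval_poly (eval_poly (eval_poly (eval_poly number
       (scalar [:0, 1:] - number (1/2) * vy^2
         + number (1/2) * (vq^2 + number (1/2) * vz)^2 + number (\<alpha> + 1/2) * vq))
       vz) (vy + vq^2 + number (1/2) * vz)) vq"

definition from_PII :: "complex \<Rightarrow> polyfun \<Rightarrow> polyfun" where
  "from_PII \<alpha> = eval_poly (eval_poly (eval_poly (eval_poly number
       (hamiltonian_poly \<alpha>)) coord_z) coord_q) (coord_p - coord_q^2 - number (1/2) * coord_z)"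

lemma ring_morphism_number: "ring_morphism number"
  by (simp add: ring_morphism_def one_pCons)

lemma ring_morphism_to_PII: "ring_morphism (to_PII \<alpha>)"
  and ring_morphism_from_PII: "ring_morphism (from_PII \<alpha>)"
  unfolding to_PII_def from_PII_def
  by (intro ring_morphism_eval_poly ring_morphism_number)+

lemmas to_PII_simps = morphism_simps[OF ring_morphism_to_PII]
lemmas from_PII_simps = morphism_simps[OF ring_morphism_from_PII]

lemma to_PII_coordinates:
  "to_PII \<alpha> (number c) = number c" "to_PII \<alpha> coord_z = vz" "to_PII \<alpha> coord_q = vq"
  "to_PII \<alpha> coord_p = vy + vq^2 + number (1/2) * vz"
  "to_PII \<alpha> coord_F = scalar [:0, 1:] - number (1/2) * vy^2
     + number (1/2) * (vq^2 + number (1/2) * vz)^2 + number (\<alpha> + 1/2) * vq"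
  unfolding to_PII_def
  by (simp_all only: eval_poly_const eval_poly_variable ring_morphism_eval_poly ring_morphism_number)

lemma from_PII_coordinates:
  "from_PII \<alpha> (number c) = number c" "from_PII \<alpha> vz = coord_z" "from_PII \<alpha> vq = coord_q"
  "from_PII \<alpha> vy = coord_p - coord_q^2 - number (1/2) * coord_z"
  "from_PII \<alpha> (scalar b) = eval_poly number (hamiltonian_poly \<alpha>) b"
  unfolding from_PII_def
  by (simp_all only: eval_poly_const eval_poly_variable ring_morphism_eval_poly ring_morphism_number)

lemma number_half: "number (1/2) + number (1/2) = 1"
  by (simp add: one_pCons)

lemma from_PII_to_PII: "from_PII \<alpha> (to_PII \<alpha> f) = f"
proof (rule polyfun_morphism_eqI)
  show "ring_morphism (\<lambda>f. from_PII \<alpha> (to_PII \<alpha> f))"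
    by (rule ring_morphism_comp[OF ring_morphism_from_PII ring_morphism_to_PII])
  have "from_PII \<alpha> (scalar [:0, 1:]) = hamiltonian_poly \<alpha>"
    by (simp only: from_PII_coordinates eval_poly_variable ring_morphism_number)
  then show "from_PII \<alpha> (to_PII \<alpha> (scalar [:0, 1:])) = scalar [:0, 1:]"
    unfolding to_PII_coordinates from_PII_simps from_PII_coordinates(1-4) hamiltonian_poly_def
    using number_half by algebra
  show "from_PII \<alpha> (to_PII \<alpha> vq) = vq"
    unfolding to_PII_coordinates from_PII_simps from_PII_coordinates(1-4)
    by (simp only: add.assoc diff_diff_eq diff_add_cancel)
qed (simp_all only: ring_morphism_id to_PII_coordinates from_PII_coordinates(1-4))

lemma to_PII_from_PII_scalar: "to_PII \<alpha> (from_PII \<alpha> (scalar b)) = scalar b"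
proof -
  have h: "from_PII \<alpha> (scalar [:0, 1:]) = hamiltonian_poly \<alpha>"
    by (simp only: from_PII_coordinates eval_poly_variable ring_morphism_number)
  note const = ring_morphism_comp_const
  have m: "ring_morphism (\<lambda>f. to_PII \<alpha> (from_PII \<alpha> f))"
    by (rule ring_morphism_comp[OF ring_morphism_to_PII ring_morphism_from_PII])
  show ?thesis
  proof (rule morphism_eqI[OF const[OF const[OF const[OF m]]] const[OF const[OF const[OF ring_morphism_id]]]])
    show "to_PII \<alpha> (from_PII \<alpha> (scalar [:0, 1:])) = scalar [:0, 1:]"
      unfolding h hamiltonian_poly_def to_PII_simps to_PII_coordinates
      using number_half by algebra
  qed (simp_all only: to_PII_coordinates from_PII_coordinates(1))
qed

lemma derivation_hamiltonian_field_poly: "derivation (hamiltonian_field_poly \<alpha>)"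
  by (simp add: derivation_def hamiltonian_field_poly_def derivation_add[OF derivation_partial_poly]
      derivation_mult[OF derivation_partial_poly] del: partial_poly.simps mult_pCons_left mult_pCons_right)
    (simp add: algebra_simps del: partial_poly.simps mult_pCons_left mult_pCons_right)

lemma partial_poly_coordinates:
  "partial_poly i (number c) = 0"
  "partial_poly i coord_q = (if i = Cq then 1 else 0)"
  "partial_poly i coord_p = (if i = Cp then 1 else 0)"
  "partial_poly i coord_z = (if i = Cz then 1 else 0)"
  "partial_poly i coord_F = (if i = CF then 1 else 0)"
  by (cases i; simp add: map_poly_pCons pderiv_pCons derivation_0 derivation_pderiv derivation_map_poly
      map_poly_1' derivation_1 flip: one_pCons)+

lemma to_PII_hamiltonian_field:
  "to_PII \<alpha> (hamiltonian_field_poly \<alpha> f) = PII_field [:\<alpha>:] (to_PII \<alpha> f)"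
proof -
  note l = derivation_along_comp(1)[OF ring_morphism_to_PII derivation_hamiltonian_field_poly]
  note r = derivation_along_comp(2)[OF ring_morphism_to_PII derivation_PII_field]
  have cubic: "[:cubic:] = 2 * vq^3 + vz * (vq :: polyfun)"
    by (simp add: cubic_def numeral_poly power3_eq_cube)
  have field: "PII_field [:\<alpha>:] (scalar c) = 0" "PII_field [:\<alpha>:] vz = 1" "PII_field [:\<alpha>:] vq = vy"
    "PII_field [:\<alpha>:] vy = 2 * vq^3 + vz * vq + number \<alpha>" for c
    by (simp_all only: PII_field_def lead_field_coordinates low_field_coordinates cubic add_0_right add_0_left)
  have D: "hamiltonian_field_poly \<alpha> (number c) = 0"
    "hamiltonian_field_poly \<alpha> coord_F = number (1/2) * coord_p"
    "hamiltonian_field_poly \<alpha> coord_z = 1"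
    "hamiltonian_field_poly \<alpha> coord_p = 2 * coord_q * coord_p + number (\<alpha> + 1/2)"
    "hamiltonian_field_poly \<alpha> coord_q = coord_p - coord_q^2 - number (1/2) * coord_z" for c
    by (simp_all only: hamiltonian_field_poly_def partial_poly_coordinates coord.simps simp_thms if_True if_False
        mult_zero_right mult_1_right add_0_right add_0_left)
  have half: "number (\<alpha> + 1/2) = number \<alpha> + number (1/2)"
    by (rule number_simps)
  show ?thesis
  proof (rule polyfun_derivation_eqI[OF l r])
    show "to_PII \<alpha> (hamiltonian_field_poly \<alpha> (number c)) = PII_field [:\<alpha>:] (to_PII \<alpha> (number c))" for c
      unfolding D to_PII_coordinates field to_PII_simps ..
    show "to_PII \<alpha> (hamiltonian_field_poly \<alpha> coord_F) = PII_field [:\<alpha>:] (to_PII \<alpha> coord_F)"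
      unfolding D to_PII_coordinates to_PII_simps PII_field_simps power2_eq_square field half
      using number_half by algebra
    show "to_PII \<alpha> (hamiltonian_field_poly \<alpha> coord_z) = PII_field [:\<alpha>:] (to_PII \<alpha> coord_z)"
      unfolding D to_PII_coordinates field to_PII_simps ..
    show "to_PII \<alpha> (hamiltonian_field_poly \<alpha> coord_p) = PII_field [:\<alpha>:] (to_PII \<alpha> coord_p)"
      unfolding D to_PII_coordinates to_PII_simps PII_field_simps power2_eq_square field half
      using number_half by algebra
    show "to_PII \<alpha> (hamiltonian_field_poly \<alpha> coord_q) = PII_field [:\<alpha>:] (to_PII \<alpha> coord_q)"
      unfolding D to_PII_coordinates to_PII_simps field
      by (simp only: add.assoc diff_diff_eq add_diff_cancel_right')
  qed
qed

text \<open>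
  For a first integral in lowest terms this yields the common cofactor of its two parts.
\<close>
lemma darboux_cofactor:
  fixes a b :: "'a::factorial_ring_gcd"
  assumes coprime: "coprime a b" and b: "b \<noteq> 0" and eq: "b * D a = a * D b"
  shows "\<exists>c. D a = c * a \<and> D b = c * b"
proof -
  have "b dvd a * D b"
    by (simp flip: eq)
  then have "b dvd D b"
    using coprime by (simp add: coprime_commute coprime_dvd_mult_right_iff)
  then obtain c where c: "D b = c * b"
    by (metis dvd_def mult.commute)
  then have "b * D a = b * (c * a)"
    using eq by (simp add: ac_simps)
  then show ?thesis
    using b c by auto
qed

lemma to_fract_hamiltonian_poly: "to_fract (hamiltonian_poly \<alpha>) = PII_hamiltonian \<alpha>"
  by (simp only: hamiltonian_poly_def PII_hamiltonian_def const_def var.simps power2_eq_square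
      to_fract_add to_fract_diff to_fract_mult)

lemma partial_to_fract: "partial i (to_fract f) = to_fract (partial_poly i f)"
  unfolding partial_def by (rule fract_derivation_to_fract[OF derivation_partial_poly])

text \<open>
  The Lie derivative is a derivation of the field of rational functions, so clearing
  denominators commutes with it.
\<close>
lemma first_integral_cross_product:
  assumes integral: "first_integral (hamiltonian_field (PII_hamiltonian \<alpha>)) \<Phi>"
    and \<Phi>: "\<Phi> * to_fract b = to_fract a"
  shows "b * hamiltonian_field_poly \<alpha> a = a * hamiltonian_field_poly \<alpha> b"
proof -
  define L where "L \<Psi> = (var Cp - (var Cq)^2 - const (1/2) * var Cz) * partial Cq \<Psi>
     + (2 * var Cq * var Cp + const (\<alpha> + 1/2)) * partial Cp \<Psi>
     + partial Cz \<Psi> + const (1/2) * var Cp * partial CF \<Psi>" for \<Psi>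
  have mult: "L (x * y) = L x * y + x * L y" for x y
    unfolding L_def partial_mult by algebra
  have "to_fract (2 :: polyfun) = 2"
    by (metis one_add_one to_fract_1 to_fract_add)
  then have L: "L (to_fract f) = to_fract (hamiltonian_field_poly \<alpha> f)" for f
    by (simp only: L_def hamiltonian_field_poly_def const_def var.simps power2_eq_square
        partial_to_fract to_fract_add to_fract_diff to_fract_mult)
  have "L \<Phi> = 0"
    using integral unfolding L_def first_integral_PII_iff .
  then have "\<Phi> * L (to_fract b) = L (to_fract a)"
    using mult[of \<Phi> "to_fract b"] by (simp add: \<Phi>)
  then have "to_fract b * L (to_fract a) = to_fract a * L (to_fract b)"
    unfolding \<Phi>[symmetric] by (simp add: ac_simps)
  then show ?thesis
    by (simp add: L flip: to_fract_mult)
qed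

text \<open>
  The chain rule: \<open>d\<close> is the derivative of the polynomial \<open>b\<close>,
  evaluated at the Hamiltonian.
\<close>
lemma partial_polynomial_in_hamiltonian:
  "\<exists>d. \<forall>i. partial i (to_fract (eval_poly number (hamiltonian_poly \<alpha>) b))
     = d * partial i (PII_hamiltonian \<alpha>)"
proof (induction b)
  case 0
  show ?case
    by (intro exI[of _ 0]) (simp add: eval_poly_0 derivation_0[OF derivation_partial])
next
  case (pCons c b)
  let ?x = "to_fract (eval_poly number (hamiltonian_poly \<alpha>) b)"
  obtain d where d: "partial i ?x = d * partial i (PII_hamiltonian \<alpha>)" for i
    using pCons.IH by blast
  have "to_fract (eval_poly number (hamiltonian_poly \<alpha>) (pCons c b))
      = const c + PII_hamiltonian \<alpha> * ?x"
    by (simp only: eval_poly_pCons[OF ring_morphism_number] to_fract_add to_fract_mult const_def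
        to_fract_hamiltonian_poly)
  then show ?case
    by (intro exI[of _ "?x + PII_hamiltonian \<alpha> * d"])
      (simp add: partial_add partial_mult partial_const d algebra_simps)
qed

theorem theorem1:
  fixes \<alpha> :: complex
  assumes "\<alpha> \<in> \<int>"
  shows "\<not> (\<exists>\<Phi> :: ratfun.
           first_integral (hamiltonian_field (PII_hamiltonian \<alpha>)) \<Phi> \<and>
           functionally_independent \<Phi> (PII_hamiltonian \<alpha>))"
proof
  assume "\<exists>\<Phi> :: ratfun.
           first_integral (hamiltonian_field (PII_hamiltonian \<alpha>)) \<Phi> \<and>
           functionally_independent \<Phi> (PII_hamiltonian \<alpha>)"
  then obtain \<Phi> where integral: "first_integral (hamiltonian_field (PII_hamiltonian \<alpha>)) \<Phi>"
    and independent: "functionally_independent \<Phi> (PII_hamiltonian \<alpha>)" by blast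
  obtain a b :: polyfun where \<Phi>: "\<Phi> * to_fract b = to_fract a" and b: "b \<noteq> 0" and coprime: "coprime a b"
  proof -
    obtain a' b' where ab': "\<Phi> = Fract a' b'" "b' \<noteq> 0" by (cases \<Phi>)
    obtain a b where ab: "a' = a * gcd a' b'" "b' = b * gcd a' b'" "coprime a b"
      using gcd_coprime_exists[of a' b'] ab'(2) by auto
    have "\<Phi> = to_fract a' / to_fract b'"
      using ab' by (simp add: Fract_conv_to_fract)
    then have "\<Phi> * to_fract b' = to_fract a'"
      using ab'(2) by simp
    then have "\<Phi> * to_fract (b * gcd a' b') = to_fract (a * gcd a' b')"
      by (simp only: ab(1,2)[symmetric])
    then have "(\<Phi> * to_fract b) * to_fract (gcd a' b') = to_fract a * to_fract (gcd a' b')"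
      by (simp only: to_fract_mult mult.assoc)
    then have "\<Phi> * to_fract b = to_fract a"
      using ab'(2) by simp
    moreover have "b \<noteq> 0"
      using ab ab'(2) by auto
    ultimately show ?thesis
      using that ab(3) by blast
  qed
  obtain c where "hamiltonian_field_poly \<alpha> a = c * a" "hamiltonian_field_poly \<alpha> b = c * b"
    using darboux_cofactor[OF coprime b first_integral_cross_product[OF integral \<Phi>]] by blast
  then have "PII_field [:\<alpha>:] (to_PII \<alpha> a) = to_PII \<alpha> c * to_PII \<alpha> a"
    "PII_field [:\<alpha>:] (to_PII \<alpha> b) = to_PII \<alpha> c * to_PII \<alpha> b"
    by (simp_all only: to_PII_simps flip: to_PII_hamiltonian_field)
  moreover have "to_PII \<alpha> b \<noteq> 0"
    using b from_PII_to_PII[of \<alpha> b] by (auto simp: from_PII_simps)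
  ultimately obtain r s where s: "s \<noteq> 0" and eq: "scalar s * to_PII \<alpha> a = scalar r * to_PII \<alpha> b"
    using darboux_proportional by blast
  let ?h = "\<lambda>t. to_fract (eval_poly number (hamiltonian_poly \<alpha>) t)"
  have "from_PII \<alpha> (scalar s) * a = from_PII \<alpha> (scalar r) * b"
    using arg_cong[OF eq, of "from_PII \<alpha>"] by (simp only: from_PII_simps from_PII_to_PII)
  then have "?h s * (\<Phi> * to_fract b) = ?h r * to_fract b"
    unfolding \<Phi> from_PII_coordinates by (simp only: flip: to_fract_mult)
  then have \<Phi>_h: "\<Phi> * ?h s = ?h r"
    using b by (simp add: ac_simps)
  have "from_PII \<alpha> (scalar s) \<noteq> 0"
    using s to_PII_from_PII_scalar[of \<alpha> s] by (auto simp: to_PII_simps)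
  then have h_s: "?h s \<noteq> 0"
    by (simp add: from_PII_coordinates)
  obtain r' s' where "\<And>i. partial i (?h r) = r' * partial i (PII_hamiltonian \<alpha>)"
    "\<And>i. partial i (?h s) = s' * partial i (PII_hamiltonian \<alpha>)"
    using partial_polynomial_in_hamiltonian by meson
  then have "partial i \<Phi> * ?h s + \<Phi> * (s' * partial i (PII_hamiltonian \<alpha>))
      = r' * partial i (PII_hamiltonian \<alpha>)" for i
    by (metis \<Phi>_h partial_mult)
  then have "partial i \<Phi> = (r' - \<Phi> * s') / ?h s * partial i (PII_hamiltonian \<alpha>)" for i
    using h_s by (simp add: field_simps)
  then have "wedge_differentials \<Phi> (PII_hamiltonian \<alpha>) i j = 0" for i j
    by (simp add: wedge_differentials_def)
  with independent show False
    by (simp add: functionally_independent_def)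
qed

end
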